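(* Let $(X,d)$ be a Polish metric space. If $\mu,\nu \in P(X)$ and $T_\mu^\infty = T_\nu^\infty$, then $\mu=\nu$. In particular, $T_\mu = T_\nu$ if and only if $T_\mu^\infty = T_\nu^\infty$.
   Context: $P(X)$ denotes the set of Borel probability measures on $X$. $\Lambda(X)$ denotes the set of all 1-Lipschitz functions $f\colon X\to\mathbb{R}$ (i.e. $|f(x)-f(y)|\le d(x,y)$ for all $x,y\in X$), called observables. For $\mu\in P(X)$, the Lipschitz transform $T_\mu\colon \Lambda(X)\to P(\mathbb{R})$ is $T_\mu(f)=f_\sharp\mu$, where $f_\sharp\mu(U)=\mu(f^{-1}(U))$ for Borel $U\subseteq\mathbb{R}$. For $a\in X$ let $f_a(x)=d(x,a)$. Let $f\wedge g$ denote the pointwise minimum of $f$ and $g$. Let $I=[0,1]$. For $0\le n<\infty$, $\alpha=(\alpha_0,\dots,\alpha_n)\in I^{n+1}$ and $a=(a_0,\dots,a_n)\in X^{n+1}$ (the points $a_i$ need not be distinct), set $f_a^\alpha=\alpha_0 f_{a_0}\wedge\cdots\wedge\alpha_n f_{a_n}\in\Lambda(X)$, and $\Lambda_n(X)=\{f_a^\alpha : \alpha\in I^{n+1},\ a\in X^{n+1}\}$. These sets are increasing in $n$, and $\Lambda_\infty(X)=\bigcup_{n}\Lambda_n(X)$. $T_\mu^\infty\colon\Lambda_\infty(X)\to P(\mathbb{R})$ denotes the restriction of $T_\mu$ to $\Lambda_\infty(X)$. *)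

theory Defs
  imports "HOL-Probability.Probability"
begin

text \<open>
  A Polish metric space is a complete separable metric space, that is, a type of class
  \<^class>\<open>polish_space\<close> with its \<^const>\<open>dist\<close>.
\<close>

definition borel_prob_measures :: "'a::topological_space measure set" where
  "borel_prob_measures = {\<mu>. sets \<mu> = sets borel \<and> prob_space \<mu>}"

definition observables :: "('a::metric_space \<Rightarrow> real) set" where
  "observables = {f. 1-lipschitz_on UNIV f}"

text \<open>
  The tuples \<open>\<alpha>\<close> and \<open>a\<close> of length \<open>n + 1\<close> are functions on \<^typ>\<open>nat\<close> of which only the
  values on \<open>{..n}\<close> matter.
\<close>

definition min_observable ::
    "nat \<Rightarrow> (nat \<Rightarrow> real) \<Rightarrow> (nat \<Rightarrow> 'a::metric_space) \<Rightarrow> 'a \<Rightarrow> real" where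
  "min_observable n \<alpha> a = (\<lambda>x. MIN i\<in>{..n}. \<alpha> i * dist x (a i))"

definition observables_n :: "nat \<Rightarrow> ('a::metric_space \<Rightarrow> real) set" where
  "observables_n n = {min_observable n \<alpha> a | \<alpha> a. \<forall>i\<le>n. \<alpha> i \<in> {0..1}}"

definition observables_inf :: "('a::metric_space \<Rightarrow> real) set" where
  "observables_inf = (\<Union>n. observables_n n)"

text \<open>
  The transforms are functions with a prescribed domain, represented by \<^const>\<open>restrict\<close>,
  so that equality of transforms is equality at every point of the domain and nothing more.
\<close>

definition lipschitz_transform ::
    "'a::metric_space measure \<Rightarrow> ('a \<Rightarrow> real) \<Rightarrow> real measure" where
  "lipschitz_transform \<mu> = (\<lambda>f\<in>observables. distr \<mu> borel f)"

definition lipschitz_transform_inf ::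
    "'a::metric_space measure \<Rightarrow> ('a \<Rightarrow> real) \<Rightarrow> real measure" where
  "lipschitz_transform_inf \<mu> = restrict (lipschitz_transform \<mu>) observables_inf"

lemma min_observable_in_observables:
  assumes "\<forall>i\<le>n. \<alpha> i \<in> {0..1}"
  shows "min_observable n \<alpha> a \<in> observables"
proof -
  have le: "min_observable n \<alpha> a x \<le> min_observable n \<alpha> a y + dist x y" for x y
  proof -
    have "Min ((\<lambda>i. \<alpha> i * dist y (a i)) ` {..n}) \<in> (\<lambda>i. \<alpha> i * dist y (a i)) ` {..n}"
      by (rule Min_in) auto
    then obtain i where i: "i \<le> n" "min_observable n \<alpha> a y = \<alpha> i * dist y (a i)"
      unfolding min_observable_def by blast
    have \<alpha>: "0 \<le> \<alpha> i" "\<alpha> i \<le> 1"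
      using assms i(1) by auto
    have "min_observable n \<alpha> a x \<le> \<alpha> i * dist x (a i)"
      unfolding min_observable_def using i(1) by (intro Min_le) auto
    also have "\<dots> \<le> \<alpha> i * (dist x y + dist y (a i))"
      by (intro mult_left_mono dist_triangle \<alpha>)
    also have "\<dots> \<le> \<alpha> i * dist y (a i) + dist x y"
      using mult_right_mono[OF \<alpha>(2), of "dist x y"] by (simp add: algebra_simps)
    finally show ?thesis
      using i(2) by simp
  qed
  have "\<bar>min_observable n \<alpha> a x - min_observable n \<alpha> a y\<bar> \<le> dist x y" for x y
    using le[of x y] le[of y x] by (simp add: dist_commute)
  then show ?thesis
    by (auto simp: observables_def lipschitz_on_def dist_real_def)
qed

lemma observables_inf_subset: "observables_inf \<subseteq> observables"
  unfolding observables_inf_def observables_n_def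
  using min_observable_in_observables by blast

lemma lipschitz_transform_funcset:
  assumes "\<mu> \<in> borel_prob_measures"
  shows "lipschitz_transform \<mu> \<in> observables \<rightarrow> borel_prob_measures"
proof
  fix f :: "'a \<Rightarrow> real"
  assume f: "f \<in> observables"
  interpret prob_space \<mu>
    using assms by (simp add: borel_prob_measures_def)
  have "sets \<mu> = sets borel"
    using assms by (simp add: borel_prob_measures_def)
  moreover have "f \<in> borel_measurable borel"
    using f lipschitz_on_continuous_on
    by (auto simp: observables_def intro!: borel_measurable_continuous_onI)
  ultimately have "f \<in> borel_measurable \<mu>"
    by (simp cong: measurable_cong_sets)
  then show "lipschitz_transform \<mu> f \<in> borel_prob_measures"
    using f by (simp add: lipschitz_transform_def borel_prob_measures_def prob_space_distr)
qed

end

theory Submission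
  imports Defs
begin

text \<open>
  If all \<open>\<alpha>\<^sub>i\<close> are positive, the set where \<open>\<alpha>\<^sub>0 f\<^bsub>a\<^sub>0\<^esub> \<and> \<dots> \<and> \<alpha>\<^sub>n f\<^bsub>a\<^sub>n\<^esub> < t\<close> is the union of
  the open balls of radius \<open>t / \<alpha>\<^sub>i\<close> about \<open>a\<^sub>i\<close>. A small level \<open>t\<close> compensates for the bound
  \<open>\<alpha>\<^sub>i \<le> 1\<close>, so that the balls may have arbitrary positive radii
  (lemma \<open>finite_union_balls_eq_sublevel\<close>). The transform on \<open>\<Lambda>\<^sub>\<infinity>\<close> thus knows the
  measure of every finite union of open balls, including all the overlaps; this is why
  minima are used, the measures of single balls being insufficient in general metric spaces.
  A separable space is hereditarily Lindeloef, so that every open set is the limit of an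
  increasing sequence of finite unions of balls, and continuity from below gives the measure
  of every open set (lemma \<open>emeasure_open_eq\<close>). The open sets are a generator of the Borel
  sets that is stable under intersection, hence they determine the measure.
\<close>

text \<open>
  With common level \<open>t\<close>, the ball of radius \<open>r i\<close> is cut out by the slope \<open>t / r i\<close>. Taking the
  smallest radius as \<open>t\<close> keeps all slopes in the unit interval.
\<close>

lemma finite_union_balls_eq_sublevel:
  fixes a :: "nat \<Rightarrow> 'a::metric_space" and r :: "nat \<Rightarrow> real"
  assumes r: "\<And>i. i \<le> n \<Longrightarrow> r i > 0"
  obtains f t where "f \<in> observables_inf" and "(\<Union>i\<le>n. ball (a i) (r i)) = f -` {..<t}"
proof
  define t where "t = Min (r ` {..n})"
  define f where "f = min_observable n (\<lambda>i. t / r i) a"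
  have t_pos: "t > 0"
    unfolding t_def using r by (subst Min_gr_iff) auto
  have t_le: "t \<le> r i" if "i \<le> n" for i
    unfolding t_def using that by (intro Min_le) auto
  have "\<forall>i\<le>n. t / r i \<in> {0..1}"
    using t_pos t_le r by (auto simp: less_imp_le)
  then show "f \<in> observables_inf"
    unfolding f_def observables_inf_def observables_n_def by blast
  have "t / r i * dist x (a i) < t \<longleftrightarrow> x \<in> ball (a i) (r i)" if "i \<le> n" for i x
    using t_pos r[OF that] by (simp add: dist_commute field_simps)
  then have "f x < t \<longleftrightarrow> (\<exists>i\<le>n. x \<in> ball (a i) (r i))" for x
    unfolding f_def min_observable_def by (subst Min_less_iff) auto
  then show "(\<Union>i\<le>n. ball (a i) (r i)) = f -` {..<t}"
    by auto
qed

lemma emeasure_finite_union_balls_eq: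
  fixes \<mu> \<nu> :: "'a::metric_space measure" and a :: "nat \<Rightarrow> 'a" and r :: "nat \<Rightarrow> real"
  assumes sets: "sets \<mu> = sets borel" "sets \<nu> = sets borel"
    and eq: "lipschitz_transform_inf \<mu> = lipschitz_transform_inf \<nu>"
    and r: "\<And>i. i \<le> n \<Longrightarrow> r i > 0"
  shows "emeasure \<mu> (\<Union>i\<le>n. ball (a i) (r i)) = emeasure \<nu> (\<Union>i\<le>n. ball (a i) (r i))"
proof -
  obtain f t where f: "f \<in> observables_inf"
    and U: "(\<Union>i\<le>n. ball (a i) (r i)) = f -` {..<t}"
    using finite_union_balls_eq_sublevel[of n r a] r by metis
  have obs: "f \<in> observables"
    using f observables_inf_subset by blast
  then have "f \<in> borel_measurable borel"
    using lipschitz_on_continuous_on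
    by (auto simp: observables_def intro!: borel_measurable_continuous_onI)
  then have meas: "f \<in> borel_measurable \<mu>" "f \<in> borel_measurable \<nu>"
    using sets by (simp_all cong: measurable_cong_sets)
  have space: "space \<mu> = UNIV" "space \<nu> = UNIV"
    using sets_eq_imp_space_eq[OF sets(1)] sets_eq_imp_space_eq[OF sets(2)] by simp_all
  have "distr \<mu> borel f = distr \<nu> borel f"
    using fun_cong[OF eq, of f] f obs
    by (simp add: lipschitz_transform_inf_def lipschitz_transform_def)
  then have "emeasure (distr \<mu> borel f) {..<t} = emeasure (distr \<nu> borel f) {..<t}"
    by simp
  then show ?thesis
    unfolding U using meas space by (simp add: emeasure_distr)
qed

lemma open_eq_countable_union_balls:
  fixes U :: "'a::{metric_space, second_countable_topology} set"
  assumes "open U" and "U \<noteq> {}"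
  obtains a :: "nat \<Rightarrow> 'a" and r where "\<And>i. r i > 0" and "U = (\<Union>i. ball (a i) (r i))"
proof -
  define \<B> where "\<B> = {ball x e | x e. e > 0 \<and> ball x e \<subseteq> U}"
  have "\<Union>\<B> = U"
  proof
    show "U \<subseteq> \<Union>\<B>"
    proof
      fix x assume "x \<in> U"
      then obtain e where "e > 0" "ball x e \<subseteq> U"
        using \<open>open U\<close> openE by blast
      then have "ball x e \<in> \<B>" "x \<in> ball x e"
        unfolding \<B>_def by auto
      then show "x \<in> \<Union>\<B>"
        by blast
    qed
  qed (auto simp: \<B>_def)
  moreover have "\<And>B. B \<in> \<B> \<Longrightarrow> open B"
    unfolding \<B>_def by auto
  ultimately obtain \<C> where \<C>: "\<C> \<subseteq> \<B>" "countable \<C>" "\<Union>\<C> = U"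
    using Lindelof[of \<B>] by metis
  then have "\<C> \<noteq> {}"
    using \<open>U \<noteq> {}\<close> by auto
  then have range: "range (from_nat_into \<C>) = \<C>"
    using \<C>(2) by (simp add: range_from_nat_into)
  have "from_nat_into \<C> i \<in> \<B>" for i
    using subsetD[OF \<C>(1) from_nat_into[OF \<open>\<C> \<noteq> {}\<close>]] .
  then have "\<forall>i. \<exists>x e. e > 0 \<and> from_nat_into \<C> i = ball x e"
    unfolding \<B>_def mem_Collect_eq by metis
  then obtain a r where "\<And>i. r i > 0" and ball: "\<And>i. from_nat_into \<C> i = ball (a i) (r i)"
    by metis
  moreover have "U = (\<Union>i. ball (a i) (r i))"
    using range \<C>(3) unfolding ball[symmetric] by simp
  ultimately show thesis
    using that by blast
qed

lemma emeasure_open_eq: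
  fixes \<mu> \<nu> :: "'a::{metric_space, second_countable_topology} measure"
  assumes sets: "sets \<mu> = sets borel" "sets \<nu> = sets borel"
    and eq: "lipschitz_transform_inf \<mu> = lipschitz_transform_inf \<nu>"
    and "open U"
  shows "emeasure \<mu> U = emeasure \<nu> U"
proof (cases "U = {}")
  case False
  then obtain a r where r: "\<And>i::nat. r i > 0" and U: "U = (\<Union>i. ball (a i) (r i))"
    using open_eq_countable_union_balls \<open>open U\<close> by metis
  define A where "A n = (\<Union>i\<le>n. ball (a i) (r i))" for n
  have "incseq A"
    unfolding A_def incseq_def by (auto intro: order_trans)
  moreover have "range A \<subseteq> sets borel"
    unfolding A_def by auto
  moreover have "(\<Union>n. A n) = U"
    unfolding A_def U by auto
  moreover have "emeasure \<mu> (A n) = emeasure \<nu> (A n)" for n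
    unfolding A_def using emeasure_finite_union_balls_eq[OF sets eq r] .
  ultimately show ?thesis
    using SUP_emeasure_incseq[of A \<mu>] SUP_emeasure_incseq[of A \<nu>] sets by simp
qed simp

theorem theorem4:
  fixes \<mu> \<nu> :: "'a::polish_space measure"
  assumes "\<mu> \<in> borel_prob_measures" and "\<nu> \<in> borel_prob_measures"
  shows "(lipschitz_transform_inf \<mu> = lipschitz_transform_inf \<nu> \<longrightarrow> \<mu> = \<nu>) \<and>
    (lipschitz_transform \<mu> = lipschitz_transform \<nu> \<longleftrightarrow>
      lipschitz_transform_inf \<mu> = lipschitz_transform_inf \<nu>)"
proof -
  have sets: "sets \<mu> = sets borel" "sets \<nu> = sets borel"
    using assms by (auto simp: borel_prob_measures_def)
  interpret \<mu>: prob_space \<mu>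
    using assms by (simp add: borel_prob_measures_def)
  have "\<mu> = \<nu>" if eq: "lipschitz_transform_inf \<mu> = lipschitz_transform_inf \<nu>"
  proof (rule measure_eqI_generator_eq[where E = "Collect open" and \<Omega> = UNIV
        and A = "\<lambda>_::nat. UNIV"])
    show "Int_stable (Collect (open :: 'a set \<Rightarrow> bool))"
      by (auto simp: Int_stable_def)
    show "emeasure \<mu> U = emeasure \<nu> U" if "U \<in> Collect open" for U
      using emeasure_open_eq[OF sets eq] that by simp
    show "sets \<mu> = sigma_sets UNIV (Collect open)" "sets \<nu> = sigma_sets UNIV (Collect open)"
      using sets by (simp_all add: borel_def)
    show "emeasure \<mu> UNIV \<noteq> \<infinity>"
      by simp
  qed simp_all
  then show ?thesis
    by (auto simp: lipschitz_transform_inf_def)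
qed

end
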